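(* Let $\mathcal G=(G_n,\|\cdot\|_n)_{n\in\mathbb N}$ be a family of metric groups with $\sup\{\|g\|_n : n\in\mathbb N,\ g\in G_n\}<\infty$, let $\mathcal U$ be a non-principal ultrafilter on $\mathbb N$, and let $\mathcal X=\{X_m\}_{m\in\mathbb N}$ be a family of metrically internal subsets of $\mathcal G^*_{\mathrm{met}}$. Then $\mathcal X$ covers $\mathcal G^*_{\mathrm{met}}$ (i.e. $\mathcal G^*_{\mathrm{met}}=\bigcup_m X_m$) if and only if the tree $T_{\mathcal G,\mathcal X}$ of $(\mathcal G,\mathcal X)$-small sequences has no infinitely long path, i.e. $T_{\mathcal G,\mathcal X}$ is a well-founded tree.
   Context: A metric group $(G,\|\cdot\|)$ is a group with a bi-invariant norm $\|\cdot\|\colon G\to[0,\infty]$: $\|e\|=0$, $\|gh\|\le\|g\|+\|h\|$, $\|g^{-1}\|=\|g\|=\|hgh^{-1}\|$, and $\|g\|=0$ iff $g=e$. The metric ultraproduct is $\mathcal G^*_{\mathrm{met}}=\prod_{n}G_n/\mathcal E$, where $\mathcal E=\{(g_n) : \lim_{n\to\mathcal U}\|g_n\|_n=0\}$, with norm $\|(g_n)/\mathcal E\|=\lim_{n\to\mathcal U}\|g_n\|_n$; $B_\varepsilon(e)$ is the open ball of radius $\varepsilon$ around $e$ in it. $X\subseteq\mathcal G^*_{\mathrm{met}}$ is metrically internal if it is the image of $\prod_nY_n$ for some $Y_n\subseteq G_n$. A finite sequence $(\varepsilon_0,\ldots,\varepsilon_n)$ of positive reals is $(\mathcal G,\mathcal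 X)$-small if $\mathcal G^*_{\mathrm{met}}\ne X_0B_{\varepsilon_0}(e)\cup\ldots\cup X_nB_{\varepsilon_n}(e)$. $T_{\mathcal G,\mathcal X}$ is the set of all finite $(\mathcal G,\mathcal X)$-small sequences; it is a tree (closed under initial segments). An infinitely long path is an infinite sequence $(\varepsilon_0,\varepsilon_1,\ldots)$ of positive reals all of whose nonempty finite initial segments are in $T_{\mathcal G,\mathcal X}$. *)

theory Defs
  imports
    "HOL-Algebra.Product_Groups"
    "HOL-Library.Extended_Nonnegative_Real"
    "HOL-Library.Sublist"
begin

locale metric_group = group G for G (structure) +
  fixes nrm :: "'a \<Rightarrow> ennreal"
  assumes nrm_one: "nrm \<one> = 0"
    and nrm_mult: "\<lbrakk>g \<in> carrier G; h \<in> carrier G\<rbrakk> \<Longrightarrow> nrm (g \<otimes> h) \<le> nrm g + nrm h"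
    and nrm_inv: "g \<in> carrier G \<Longrightarrow> nrm (inv g) = nrm g"
    and nrm_conj: "\<lbrakk>g \<in> carrier G; h \<in> carrier G\<rbrakk> \<Longrightarrow> nrm (h \<otimes> g \<otimes> inv h) = nrm g"
    and nrm_eq_0_iff: "g \<in> carrier G \<Longrightarrow> nrm g = 0 \<longleftrightarrow> g = \<one>"

definition ultrafilter :: "'i filter \<Rightarrow> bool" where
  "ultrafilter U \<longleftrightarrow>
     U \<noteq> bot \<and> (\<forall>P. eventually P U \<or> eventually (\<lambda>i. \<not> P i) U)"

definition nonprincipal :: "'i filter \<Rightarrow> bool" where
  "nonprincipal U \<longleftrightarrow> (\<forall>i. \<not> eventually (\<lambda>j. j = i) U)"

definition null_seqs ::
    "nat filter \<Rightarrow> (nat \<Rightarrow> ('a, 'b) monoid_scheme) \<Rightarrow> (nat \<Rightarrow> 'a \<Rightarrow> ennreal) \<Rightarrow> (nat \<Rightarrow> 'a) set"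
  where
  "null_seqs U G nrm =
     {g \<in> carrier (product_group UNIV G). ((\<lambda>n. nrm n (g n)) \<longlongrightarrow> 0) U}"

definition met_ultraproduct ::
    "nat filter \<Rightarrow> (nat \<Rightarrow> ('a, 'b) monoid_scheme) \<Rightarrow> (nat \<Rightarrow> 'a \<Rightarrow> ennreal)
      \<Rightarrow> (nat \<Rightarrow> 'a) set monoid"
  where
  "met_ultraproduct U G nrm = product_group UNIV G Mod null_seqs U G nrm"

definition met_class ::
    "nat filter \<Rightarrow> (nat \<Rightarrow> ('a, 'b) monoid_scheme) \<Rightarrow> (nat \<Rightarrow> 'a \<Rightarrow> ennreal)
      \<Rightarrow> (nat \<Rightarrow> 'a) \<Rightarrow> (nat \<Rightarrow> 'a) set"
  where
  "met_class U G nrm g = null_seqs U G nrm #>\<^bsub>product_group UNIV G\<^esub> g"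

text \<open>Along an ultrafilter the limit below always exists and is the same for all representatives
  of a class, so the image in the next definition is a singleton.\<close>

definition ultra_norm ::
    "nat filter \<Rightarrow> (nat \<Rightarrow> 'a \<Rightarrow> ennreal) \<Rightarrow> (nat \<Rightarrow> 'a) set \<Rightarrow> ennreal"
  where
  "ultra_norm U nrm a = the_elem ((\<lambda>g. Lim U (\<lambda>n. nrm n (g n))) ` a)"

definition ultra_ball ::
    "nat filter \<Rightarrow> (nat \<Rightarrow> ('a, 'b) monoid_scheme) \<Rightarrow> (nat \<Rightarrow> 'a \<Rightarrow> ennreal)
      \<Rightarrow> real \<Rightarrow> (nat \<Rightarrow> 'a) set set"
  where
  "ultra_ball U G nrm \<epsilon> =
     {a \<in> carrier (met_ultraproduct U G nrm). ultra_norm U nrm a < ennreal \<epsilon>}"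

definition metrically_internal ::
    "nat filter \<Rightarrow> (nat \<Rightarrow> ('a, 'b) monoid_scheme) \<Rightarrow> (nat \<Rightarrow> 'a \<Rightarrow> ennreal)
      \<Rightarrow> (nat \<Rightarrow> 'a) set set \<Rightarrow> bool"
  where
  "metrically_internal U G nrm X \<longleftrightarrow>
     (\<exists>Y. (\<forall>n. Y n \<subseteq> carrier (G n)) \<and> X = met_class U G nrm ` (\<Pi>\<^sub>E n\<in>UNIV. Y n))"

definition small_seqs ::
    "nat filter \<Rightarrow> (nat \<Rightarrow> ('a, 'b) monoid_scheme) \<Rightarrow> (nat \<Rightarrow> 'a \<Rightarrow> ennreal)
      \<Rightarrow> (nat \<Rightarrow> (nat \<Rightarrow> 'a) set set) \<Rightarrow> real list set"
  where
  "small_seqs U G nrm X =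
     {es. es \<noteq> [] \<and> (\<forall>\<epsilon>\<in>set es. \<epsilon> > 0) \<and>
        carrier (met_ultraproduct U G nrm) \<noteq>
          (\<Union>i<length es. X i <#>\<^bsub>met_ultraproduct U G nrm\<^esub> ultra_ball U G nrm (es ! i))}"

definition infinite_path :: "real list set \<Rightarrow> (nat \<Rightarrow> real) \<Rightarrow> bool" where
  "infinite_path T \<epsilon> \<longleftrightarrow> (\<forall>n. \<epsilon> n > 0) \<and> (\<forall>n. map \<epsilon> [0..<Suc n] \<in> T)"

text \<open>Proper extensions count as smaller: infinite descending chains run upwards in the tree.\<close>

definition well_founded_tree :: "'a list set \<Rightarrow> bool" where
  "well_founded_tree T \<longleftrightarrow> wf {(t, s). s \<in> T \<and> t \<in> T \<and> strict_prefix s t}"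

end

theory Submission
  imports Defs
begin

text \<open>Countable saturation along a nonprincipal ultrafilter (a diagonal argument over
  representatives) gives two facts. Metrically internal sets are closed, so a point outside every
  \<open>X\<^sub>m\<close> lies outside \<open>X\<^sub>m B(\<epsilon>\<^sub>m)\<close> for some \<open>\<epsilon>\<^sub>m > 0\<close>, and these \<open>\<epsilon>\<^sub>m\<close> form an infinite path.
  Conversely, along an infinite path the complements of the finite unions
  \<open>X\<^sub>0 B(\<epsilon>\<^sub>0) \<union> \<dots> \<union> X\<^sub>n B(\<epsilon>\<^sub>n)\<close> are nonempty, and diagonalising over points chosen in them, at the
  cost of halving the radii, produces a point outside every \<open>X\<^sub>m\<close>.\<close>

section \<open>Ultrafilters\<close>

text \<open>The limit is the supremum of the eventual lower bounds of \<open>f\<close>. A value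
  above it is not an eventual lower bound, so the ultrafilter puts \<open>f\<close> eventually below
  that value.\<close>

lemma ultrafilter_tendsto_Lim:
  fixes f :: "'i \<Rightarrow> 'b::{complete_linorder, linorder_topology}"
  assumes "ultrafilter U"
  shows "(f \<longlongrightarrow> Lim U f) U"
proof -
  let ?S = "{a. eventually (\<lambda>x. a \<le> f x) U}"
  have "(f \<longlongrightarrow> Sup ?S) U"
  proof (rule order_tendstoI)
    fix a assume "a < Sup ?S"
    then obtain b where "eventually (\<lambda>x. b \<le> f x) U" "a < b"
      by (auto simp: less_Sup_iff)
    then show "eventually (\<lambda>x. a < f x) U"
      by (auto elim: eventually_mono)
  next
    fix a assume "Sup ?S < a"
    then have "\<not> eventually (\<lambda>x. a \<le> f x) U"
      by (meson Sup_upper mem_Collect_eq leD)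
    then have "eventually (\<lambda>x. \<not> a \<le> f x) U"
      using assms unfolding ultrafilter_def by blast
    then show "eventually (\<lambda>x. f x < a) U"
      by (simp add: not_le)
  qed
  moreover have "U \<noteq> bot"
    using assms by (simp add: ultrafilter_def)
  ultimately show ?thesis
    by (metis tendsto_Lim)
qed

lemma not_eventually_ultrafilter:
  assumes "ultrafilter U"
  shows "\<not> eventually P U \<longleftrightarrow> eventually (\<lambda>i. \<not> P i) U"
proof
  assume "eventually (\<lambda>i. \<not> P i) U"
  then show "\<not> eventually P U"
    using assms eventually_conj[of P U "\<lambda>i. \<not> P i"]
    by (auto simp: ultrafilter_def eventually_False)
qed (use assms in \<open>auto simp: ultrafilter_def\<close>)

lemma nonprincipal_eventually_ge:
  fixes U :: "nat filter"
  assumes "ultrafilter U" "nonprincipal U"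
  shows "eventually (\<lambda>k. n \<le> k) U"
proof -
  have "eventually (\<lambda>k. k \<noteq> i) U" for i
    using assms not_eventually_ultrafilter[OF assms(1), of "\<lambda>k. k = i"]
    by (auto simp: nonprincipal_def)
  then have "eventually (\<lambda>k. \<forall>i\<in>{..<n}. k \<noteq> i) U"
    by (intro eventually_ball_finite) auto
  then show ?thesis
    by (rule eventually_mono) (auto simp: not_less[symmetric])
qed

text \<open>The combinatorial content of \<open>\<aleph>\<^sub>1\<close>-saturation.\<close>

lemma ultrafilter_diagonal:
  fixes U :: "nat filter" and A :: "nat \<Rightarrow> nat \<Rightarrow> bool"
  assumes "ultrafilter U" "nonprincipal U"
    and "\<And>n. eventually (A n) U"
  shows "\<exists>m. \<forall>n. eventually (\<lambda>k. n \<le> m k \<and> A (m k) k) U"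
proof (intro exI allI)
  fix n
  \<comment> \<open>The index is the largest \<open>j\<close> with \<open>A j k\<close>; the bound
    \<open>j \<le> k\<close> keeps the set finite. If the set is empty the value of
    \<open>Max\<close> is arbitrary, which matters only outside a set of \<open>U\<close>.\<close>
  let ?m = "\<lambda>k. Max {j. j \<le> k \<and> A j k}"
  have "eventually (\<lambda>k. n \<le> k \<and> A n k) U"
    using nonprincipal_eventually_ge[OF assms(1,2)] assms(3) by (rule eventually_conj)
  then show "eventually (\<lambda>k. n \<le> ?m k \<and> A (?m k) k) U"
  proof (rule eventually_mono)
    fix k assume k: "n \<le> k \<and> A n k"
    have "finite {j. j \<le> k \<and> A j k}" by simp
    with k show "n \<le> ?m k \<and> A (?m k) k"
      using Max_in[of "{j. j \<le> k \<and> A j k}"] Max_ge[of "{j. j \<le> k \<and> A j k}" n] by blast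
  qed
qed

section \<open>The metric ultraproduct\<close>

locale metric_ultraproduct =
  fixes G :: "nat \<Rightarrow> ('a, 'b) monoid_scheme"
    and nrm :: "nat \<Rightarrow> 'a \<Rightarrow> ennreal"
    and U :: "nat filter"
  assumes metric_groups: "\<And>n. metric_group (G n) (nrm n)"
    and ultra: "ultrafilter U"
begin

abbreviation "P \<equiv> product_group UNIV G"
abbreviation "N \<equiv> null_seqs U G nrm"
abbreviation "Q \<equiv> met_ultraproduct U G nrm"
abbreviation "cls \<equiv> met_class U G nrm"
abbreviation "ball \<equiv> ultra_ball U G nrm"

text \<open>The pseudonorm on representatives. Statements about classes are reduced to it through
  \<open>cls_eq_iff\<close>, \<open>ultra_norm_cls\<close> and
  \<open>mem_image_cls_mult_ball\<close>.\<close>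

definition seq_norm :: "(nat \<Rightarrow> 'a) \<Rightarrow> ennreal" where
  "seq_norm g = Lim U (\<lambda>n. nrm n (g n))"

lemma groups: "group (G n)"
  using metric_groups by (simp add: metric_group_def)

sublocale prod: group P
  using groups by simp

lemma nontrivial: "U \<noteq> bot"
  using ultra by (simp add: ultrafilter_def)

lemma mem_carrier_P: "g \<in> carrier P \<longleftrightarrow> (\<forall>n. g n \<in> carrier (G n))"
  by (auto simp: PiE_UNIV_domain)

lemma mult_P: "(g \<otimes>\<^bsub>P\<^esub> h) n = g n \<otimes>\<^bsub>G n\<^esub> h n"
  by simp

lemma inv_P: "g \<in> carrier P \<Longrightarrow> (inv\<^bsub>P\<^esub> g) n = inv\<^bsub>G n\<^esub> g n"
  using groups by simp

lemma one_P: "\<one>\<^bsub>P\<^esub> n = \<one>\<^bsub>G n\<^esub>"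
  by simp

declare carrier_product_group [simp del] mult_product_group [simp del]
  one_product_group [simp del] inv_product_group [simp del]

section \<open>The limit pseudonorm on sequences\<close>

lemma tendsto_seq_norm: "((\<lambda>n. nrm n (g n)) \<longlongrightarrow> seq_norm g) U"
  unfolding seq_norm_def using ultra by (rule ultrafilter_tendsto_Lim)

lemma seq_norm_eqI: "((\<lambda>n. nrm n (g n)) \<longlongrightarrow> l) U \<Longrightarrow> seq_norm g = l"
  unfolding seq_norm_def using nontrivial by (intro tendsto_Lim)

lemma eventually_less_seq_norm:
  "seq_norm g < a \<Longrightarrow> eventually (\<lambda>n. nrm n (g n) < a) U"
  using tendsto_seq_norm by (rule order_tendstoD)

lemma seq_norm_leI: "eventually (\<lambda>n. nrm n (g n) \<le> a) U \<Longrightarrow> seq_norm g \<le> a"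
  using nontrivial tendsto_seq_norm by (intro tendsto_upperbound)

lemma seq_norm_geI: "eventually (\<lambda>n. a \<le> nrm n (g n)) U \<Longrightarrow> a \<le> seq_norm g"
  using nontrivial tendsto_seq_norm by (intro tendsto_lowerbound)

lemma seq_norm_one: "seq_norm \<one>\<^bsub>P\<^esub> = 0"
  by (rule seq_norm_eqI) (simp add: one_P metric_group.nrm_one[OF metric_groups])

lemma seq_norm_mult:
  assumes "g \<in> carrier P" "h \<in> carrier P"
  shows "seq_norm (g \<otimes>\<^bsub>P\<^esub> h) \<le> seq_norm g + seq_norm h"
proof (rule tendsto_le[OF nontrivial])
  show "((\<lambda>n. nrm n (g n) + nrm n (h n)) \<longlongrightarrow> seq_norm g + seq_norm h) U"
    by (intro tendsto_add tendsto_seq_norm)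
  show "((\<lambda>n. nrm n ((g \<otimes>\<^bsub>P\<^esub> h) n)) \<longlongrightarrow> seq_norm (g \<otimes>\<^bsub>P\<^esub> h)) U"
    by (rule tendsto_seq_norm)
qed (use assms in \<open>simp add: mult_P mem_carrier_P metric_group.nrm_mult[OF metric_groups]\<close>)

lemma seq_norm_inv: "g \<in> carrier P \<Longrightarrow> seq_norm (inv\<^bsub>P\<^esub> g) = seq_norm g"
  by (simp add: seq_norm_def inv_P mem_carrier_P metric_group.nrm_inv[OF metric_groups])

lemma seq_norm_conj:
  assumes "g \<in> carrier P" "h \<in> carrier P"
  shows "seq_norm (h \<otimes>\<^bsub>P\<^esub> g \<otimes>\<^bsub>P\<^esub> inv\<^bsub>P\<^esub> h) = seq_norm g"
  using assms
  by (simp add: seq_norm_def mult_P inv_P mem_carrier_P metric_group.nrm_conj[OF metric_groups])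

lemma mem_null_seqs: "g \<in> N \<longleftrightarrow> g \<in> carrier P \<and> seq_norm g = 0"
  using tendsto_seq_norm[of g] seq_norm_eqI[of g 0] by (auto simp: null_seqs_def)

text \<open>The triangle inequality and invariance under inversion give a subgroup; conjugation
  invariance gives normality.\<close>

lemma normal_null_seqs: "N \<lhd> P"
proof (rule prod.normal_invI)
  show "subgroup N P"
  proof (rule prod.subgroupI)
    show "N \<noteq> {}"
      using mem_null_seqs seq_norm_one prod.one_closed by blast
    show "g \<otimes>\<^bsub>P\<^esub> h \<in> N" if "g \<in> N" "h \<in> N" for g h
      using that seq_norm_mult[of g h] by (auto simp: mem_null_seqs)
  qed (auto simp: mem_null_seqs seq_norm_inv)
  show "g \<otimes>\<^bsub>P\<^esub> h \<otimes>\<^bsub>P\<^esub> inv\<^bsub>P\<^esub> g \<in> N" if "g \<in> carrier P" "h \<in> N" for g h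
    using that by (simp add: mem_null_seqs seq_norm_conj)
qed

sublocale nulls: normal N P
  by (rule normal_null_seqs)

section \<open>The quotient map, its norm and its balls\<close>

sublocale cls_hom: group_hom P Q cls
proof -
  have "cls = (\<lambda>g. N #>\<^bsub>P\<^esub> g)"
    by (simp add: met_class_def fun_eq_iff)
  moreover have "Q = P Mod N"
    by (simp add: met_ultraproduct_def)
  ultimately show "group_hom P Q cls"
    using nulls.r_coset_hom_Mod nulls.factorgroup_is_group prod.is_group
    by (auto simp: group_hom_def group_hom_axioms_def)
qed

lemma carrier_Q: "carrier Q = cls ` carrier P"
  by (simp add: met_ultraproduct_def met_class_def carrier_FactGroup)

lemma cls_eq_one_iff: "g \<in> carrier P \<Longrightarrow> cls g = \<one>\<^bsub>Q\<^esub> \<longleftrightarrow> seq_norm g = 0"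
  using prod.coset_join1[of N g] prod.coset_join2[of g N] nulls.subgroup_axioms
  by (auto simp: met_ultraproduct_def FactGroup_def met_class_def mem_null_seqs)

lemma cls_eq_iff:
  assumes "g \<in> carrier P" "h \<in> carrier P"
  shows "cls g = cls h \<longleftrightarrow> seq_norm (inv\<^bsub>P\<^esub> h \<otimes>\<^bsub>P\<^esub> g) = 0"
proof -
  have "cls g = cls h \<longleftrightarrow> cls h \<otimes>\<^bsub>Q\<^esub> \<one>\<^bsub>Q\<^esub> = cls g"
    using assms by auto
  also have "\<dots> \<longleftrightarrow> inv\<^bsub>Q\<^esub> cls h \<otimes>\<^bsub>Q\<^esub> cls g = \<one>\<^bsub>Q\<^esub>"
    using assms cls_hom.H.inv_solve_left'[of "\<one>\<^bsub>Q\<^esub>" "cls h" "cls g"] by auto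
  finally show ?thesis
    using assms cls_eq_one_iff[of "inv\<^bsub>P\<^esub> h \<otimes>\<^bsub>P\<^esub> g"] by simp
qed

text \<open>Two representatives differ by a null factor, so the triangle inequality in both
  directions equates their pseudonorms. Hence the image under \<open>the_elem\<close> in
  \<open>ultra_norm\<close> is a singleton.\<close>

lemma ultra_norm_cls:
  assumes "g \<in> carrier P"
  shows "ultra_norm U nrm (cls g) = seq_norm g"
proof -
  have "seq_norm x = seq_norm g" if x: "x \<in> cls g" for x
  proof -
    obtain h where h: "h \<in> N" "x = h \<otimes>\<^bsub>P\<^esub> g"
      using x by (auto simp: met_class_def r_coset_def)
    then have hP: "h \<in> carrier P" "seq_norm h = 0"
      by (auto simp: mem_null_seqs)
    have "g = inv\<^bsub>P\<^esub> h \<otimes>\<^bsub>P\<^esub> x"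
      using h hP assms by (simp flip: prod.m_assoc)
    then have "seq_norm g \<le> seq_norm (inv\<^bsub>P\<^esub> h) + seq_norm x"
      using seq_norm_mult[of "inv\<^bsub>P\<^esub> h" x] h hP assms by simp
    moreover have "seq_norm x \<le> seq_norm h + seq_norm g"
      using seq_norm_mult[of h g] h hP assms by simp
    ultimately show ?thesis
      using hP by (simp add: seq_norm_inv)
  qed
  moreover have "g \<in> cls g"
    unfolding met_class_def using assms nulls.subgroup_axioms by (rule prod.rcos_self)
  ultimately have "(\<lambda>x. Lim U (\<lambda>n. nrm n (x n))) ` cls g = {seq_norm g}"
    unfolding seq_norm_def[symmetric] by blast
  then show ?thesis
    by (simp add: ultra_norm_def)
qed

text \<open>An equation \<open>cls g = cls y * b\<close> forces \<open>b\<close> to be the class of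
  \<open>inv y * g\<close>. The product with a ball is thus an open neighbourhood for the
  left-invariant distance \<open>seq_norm (inv y * g)\<close>, and membership can be tested on
  representatives.\<close>

lemma mem_image_cls_mult_ball:
  assumes "Z \<subseteq> carrier P" "g \<in> carrier P"
  shows "cls g \<in> cls ` Z <#>\<^bsub>Q\<^esub> ball e
    \<longleftrightarrow> (\<exists>y\<in>Z. seq_norm (inv\<^bsub>P\<^esub> y \<otimes>\<^bsub>P\<^esub> g) < ennreal e)"
proof
  assume "cls g \<in> cls ` Z <#>\<^bsub>Q\<^esub> ball e"
  then obtain y b where y: "y \<in> Z" and b: "b \<in> ball e" and eq: "cls g = cls y \<otimes>\<^bsub>Q\<^esub> b"
    by (auto simp: set_mult_def)
  have "b = inv\<^bsub>Q\<^esub> cls y \<otimes>\<^bsub>Q\<^esub> cls g"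
    unfolding eq using y b assms(1) cls_hom.H.inv_solve_left[of b "cls y" "cls y \<otimes>\<^bsub>Q\<^esub> b"]
    by (simp add: ultra_ball_def subset_iff)
  also have "\<dots> = cls (inv\<^bsub>P\<^esub> y \<otimes>\<^bsub>P\<^esub> g)"
    using y assms by auto
  finally have "seq_norm (inv\<^bsub>P\<^esub> y \<otimes>\<^bsub>P\<^esub> g) < ennreal e"
    using y b assms ultra_norm_cls[of "inv\<^bsub>P\<^esub> y \<otimes>\<^bsub>P\<^esub> g"]
    unfolding ultra_ball_def subset_iff
    by (metis (mono_tags, lifting) mem_Collect_eq prod.inv_closed prod.m_closed)
  with y show "\<exists>y\<in>Z. seq_norm (inv\<^bsub>P\<^esub> y \<otimes>\<^bsub>P\<^esub> g) < ennreal e"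
    by blast
next
  assume "\<exists>y\<in>Z. seq_norm (inv\<^bsub>P\<^esub> y \<otimes>\<^bsub>P\<^esub> g) < ennreal e"
  then obtain y where y: "y \<in> Z" "seq_norm (inv\<^bsub>P\<^esub> y \<otimes>\<^bsub>P\<^esub> g) < ennreal e" by blast
  then have yP: "y \<in> carrier P" using assms by auto
  define z where "z = inv\<^bsub>P\<^esub> y \<otimes>\<^bsub>P\<^esub> g"
  have z: "z \<in> carrier P" "g = y \<otimes>\<^bsub>P\<^esub> z"
    using yP assms by (simp_all add: z_def prod.inv_solve_left[symmetric])
  have "cls z \<in> ball e"
    using y(2) z(1) by (simp add: ultra_ball_def ultra_norm_cls flip: z_def)
  moreover have "cls g = cls y \<otimes>\<^bsub>Q\<^esub> cls z"
    using yP z by simp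
  ultimately show "cls g \<in> cls ` Z <#>\<^bsub>Q\<^esub> ball e"
    using y by (auto simp: set_mult_def)
qed

section \<open>Metrically internal sets\<close>

text \<open>An empty internal set may have nonempty fibres at some indices. Emptying all fibres in that
  case makes the fibres nonempty at every index or at none.\<close>

lemma metrically_internal_cases:
  assumes "metrically_internal U G nrm X"
  obtains Y where "\<And>n. Y n \<subseteq> carrier (G n)" "X = cls ` (\<Pi>\<^sub>E n\<in>UNIV. Y n)"
    "(\<forall>n. Y n \<noteq> {}) \<or> (\<forall>n. Y n = {})"
proof -
  obtain Y where Y: "\<And>n. Y n \<subseteq> carrier (G n)" "X = cls ` (\<Pi>\<^sub>E n\<in>UNIV. Y n)"
    using assms by (auto simp: metrically_internal_def)
  show thesis
  proof (cases "\<forall>n. Y n \<noteq> {}")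
    case False
    then have "X = cls ` (\<Pi>\<^sub>E n\<in>(UNIV::nat set). ({}::'a set))"
      using Y(2) by (auto simp: PiE_eq_empty_iff)
    then show ?thesis
      using that[of "\<lambda>_. {}"] by simp
  next
    case True
    with Y show ?thesis
      by (intro that[of Y]) auto
  qed
qed

lemma PiE_subset_carrier_P: "(\<And>n. Y n \<subseteq> carrier (G n)) \<Longrightarrow> (\<Pi>\<^sub>E n\<in>UNIV. Y n) \<subseteq> carrier P"
  unfolding carrier_product_group by (rule PiE_mono)

lemma metrically_internal_subset: "metrically_internal U G nrm X \<Longrightarrow> X \<subseteq> carrier Q"
  unfolding metrically_internal_def carrier_Q
  by (elim exE conjE) (simp only: image_mono PiE_subset_carrier_P)

lemma subset_mult_ball:
  assumes "X \<subseteq> carrier Q" "e > 0"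
  shows "X \<subseteq> X <#>\<^bsub>Q\<^esub> ball e"
proof
  fix a assume a: "a \<in> X"
  have "\<one>\<^bsub>Q\<^esub> \<in> ball e"
    using ultra_norm_cls[of "\<one>\<^bsub>P\<^esub>"] assms(2) by (simp add: ultra_ball_def seq_norm_one)
  moreover have "a = a \<otimes>\<^bsub>Q\<^esub> \<one>\<^bsub>Q\<^esub>"
    using a assms(1) by auto
  ultimately show "a \<in> X <#>\<^bsub>Q\<^esub> ball e"
    using a unfolding set_mult_def by blast
qed

lemma mult_ball_subset: "X \<subseteq> carrier Q \<Longrightarrow> X <#>\<^bsub>Q\<^esub> ball e \<subseteq> carrier Q"
  by (rule cls_hom.H.set_mult_closed) (simp_all add: ultra_ball_def Collect_subset)

text \<open>Approximants of ever better precision exist in \<open>Y\<close>; choosing the precision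
  separately at each coordinate merges them into one sequence at distance 0 from
  \<open>g\<close>.\<close>

lemma metrically_internal_closed:
  assumes "nonprincipal U" "metrically_internal U G nrm X" "a \<in> carrier Q"
    and near: "\<And>e. e > 0 \<Longrightarrow> a \<in> X <#>\<^bsub>Q\<^esub> ball e"
  shows "a \<in> X"
proof -
  obtain Y where Y: "\<And>n. Y n \<subseteq> carrier (G n)" "X = cls ` (\<Pi>\<^sub>E n\<in>UNIV. Y n)"
    using assms(2) by (auto simp: metrically_internal_def)
  obtain g where g: "g \<in> carrier P" "a = cls g"
    using assms(3) by (auto simp: carrier_Q)
  have YP: "(\<Pi>\<^sub>E n\<in>UNIV. Y n) \<subseteq> carrier P"
    using Y(1) by (rule PiE_subset_carrier_P)
  define \<delta> where "\<delta> j = ennreal (1 / real (Suc j))" for j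
  let ?d = "\<lambda>k y. nrm k (inv\<^bsub>G k\<^esub> y \<otimes>\<^bsub>G k\<^esub> g k)"
  have close: "\<exists>y\<in>(\<Pi>\<^sub>E n\<in>UNIV. Y n). seq_norm (inv\<^bsub>P\<^esub> y \<otimes>\<^bsub>P\<^esub> g) < \<delta> j" for j
    using near[of "1 / real (Suc j)"] mem_image_cls_mult_ball[OF YP g(1)] Y(2) g(2)
    by (simp add: \<delta>_def)
  \<comment> \<open>This sequence only supplies default values: it shows that every fibre
    \<open>Y k\<close> is nonempty.\<close>
  then obtain y0 where y0: "y0 \<in> (\<Pi>\<^sub>E n\<in>UNIV. Y n)" by blast
  have "eventually (\<lambda>k. \<exists>y\<in>Y k. ?d k y < \<delta> j) U" for j
  proof -
    obtain y where y: "y \<in> (\<Pi>\<^sub>E n\<in>UNIV. Y n)" "seq_norm (inv\<^bsub>P\<^esub> y \<otimes>\<^bsub>P\<^esub> g) < \<delta> j"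
      using close by blast
    show ?thesis
      using eventually_less_seq_norm[OF y(2)]
      by (rule eventually_mono) (use y(1) YP in \<open>auto simp: mult_P inv_P subset_iff\<close>)
  qed
  \<comment> \<open>At coordinate \<open>k\<close> the precision is \<open>\<delta> (m k)\<close>,
    where \<open>m\<close> tends to infinity along \<open>U\<close>.\<close>
  from ultrafilter_diagonal[OF ultra assms(1), where A = "\<lambda>j k. \<exists>y\<in>Y k. ?d k y < \<delta> j", OF this]
  obtain m where m: "\<And>j. eventually (\<lambda>k. j \<le> m k \<and> (\<exists>y\<in>Y k. ?d k y < \<delta> (m k))) U"
    by blast
  \<comment> \<open>Take a good approximant where one exists and any element of the fibre elsewhere,
    so that the choice is a full sequence in the product of the fibres.\<close>
  have "\<exists>y. y \<in> Y k \<and> ((\<exists>y\<in>Y k. ?d k y < \<delta> (m k)) \<longrightarrow> ?d k y < \<delta> (m k))" for k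
    using y0 by blast
  then obtain y where yY: "\<And>k. y k \<in> Y k"
    and y: "\<And>k. (\<exists>y\<in>Y k. ?d k y < \<delta> (m k)) \<Longrightarrow> ?d k (y k) < \<delta> (m k)"
    by metis
  have y_PiE: "y \<in> (\<Pi>\<^sub>E n\<in>UNIV. Y n)" and yP: "y \<in> carrier P"
    using yY Y(1) by (auto simp: mem_carrier_P)
  have "seq_norm (inv\<^bsub>P\<^esub> y \<otimes>\<^bsub>P\<^esub> g) \<le> \<delta> j" for j
  proof (rule seq_norm_leI, rule eventually_mono[OF m[of j]])
    fix k assume k: "j \<le> m k \<and> (\<exists>y\<in>Y k. ?d k y < \<delta> (m k))"
    then have "\<delta> (m k) \<le> \<delta> j"
      by (auto simp: \<delta>_def intro!: ennreal_leI divide_left_mono)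
    with k y[of k] show "nrm k ((inv\<^bsub>P\<^esub> y \<otimes>\<^bsub>P\<^esub> g) k) \<le> \<delta> j"
      using yP by (auto simp: mult_P inv_P)
  qed
  moreover have "\<delta> \<longlonglongrightarrow> 0"
    unfolding \<delta>_def using tendsto_ennrealI[OF LIMSEQ_Suc[OF lim_1_over_n]] by simp
  ultimately have "seq_norm (inv\<^bsub>P\<^esub> y \<otimes>\<^bsub>P\<^esub> g) = 0"
    using LIMSEQ_le_const[of \<delta> 0] by (metis le_zero_eq)
  then have "cls g = cls y"
    using cls_eq_iff[OF g(1) yP] by simp
  then show ?thesis
    using y_PiE Y(2) g(2) by auto
qed

text \<open>The points given by \<open>far\<close> may depend on \<open>n\<close>. Their distance
  bounds hold coordinatewise on sets of \<open>U\<close> once the radii are halved, so a diagonal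
  sequence inherits the bound for every \<open>i\<close> and stays at positive distance from every
  \<open>X i\<close>.\<close>

lemma metrically_internal_saturated:
  fixes X :: "nat \<Rightarrow> (nat \<Rightarrow> 'a) set set" and \<epsilon> :: "nat \<Rightarrow> real"
  assumes "nonprincipal U" "\<And>m. metrically_internal U G nrm (X m)" "\<And>m. \<epsilon> m > 0"
    and far: "\<And>n. \<exists>a\<in>carrier Q. \<forall>i\<le>n. a \<notin> X i <#>\<^bsub>Q\<^esub> ball (\<epsilon> i)"
  shows "\<exists>a\<in>carrier Q. \<forall>i. a \<notin> X i"
proof -
  have "\<exists>Y. (\<forall>n. Y n \<subseteq> carrier (G n)) \<and> X i = cls ` (\<Pi>\<^sub>E n\<in>UNIV. Y n)
      \<and> ((\<forall>n. Y n \<noteq> {}) \<or> (\<forall>n. Y n = {}))" for i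
    by (rule metrically_internal_cases[OF assms(2)[of i]]) blast
  then obtain Y where Y: "\<And>i n. Y i n \<subseteq> carrier (G n)" "\<And>i. X i = cls ` (\<Pi>\<^sub>E n\<in>UNIV. Y i n)"
    and uniform: "\<And>i. (\<forall>n. Y i n \<noteq> {}) \<or> (\<forall>n. Y i n = {})"
    by metis
  have YP: "(\<Pi>\<^sub>E n\<in>UNIV. Y i n) \<subseteq> carrier P" for i
    using Y(1) by (rule PiE_subset_carrier_P)
  have "\<exists>g\<in>carrier P. \<forall>i\<le>n. cls g \<notin> X i <#>\<^bsub>Q\<^esub> ball (\<epsilon> i)" for n
    using far[of n] by (auto simp: carrier_Q)
  then obtain g where gP: "\<And>n. g n \<in> carrier P"
    and g: "\<And>n i. i \<le> n \<Longrightarrow> cls (g n) \<notin> X i <#>\<^bsub>Q\<^esub> ball (\<epsilon> i)"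
    by metis
  \<comment> \<open>\<open>A n k\<close> says that coordinate \<open>k\<close> of \<open>g n\<close>
    is at least \<open>\<epsilon> i / 2\<close> away from the whole fibre \<open>Y i k\<close>, for
    each \<open>i \<le> n\<close>.\<close>
  define A where "A = (\<lambda>n k.
    \<forall>i\<in>{..n}. \<forall>y\<in>Y i k. ennreal (\<epsilon> i / 2) \<le> nrm k (inv\<^bsub>G k\<^esub> y \<otimes>\<^bsub>G k\<^esub> g n k))"
  have "eventually (A n) U" for n
    unfolding A_def
  proof (rule eventually_ball_finite[OF finite_atMost], rule ballI)
    fix i assume i: "i \<in> {..n}"
    let ?B = "\<lambda>k y. y \<in> Y i k \<and> nrm k (inv\<^bsub>G k\<^esub> y \<otimes>\<^bsub>G k\<^esub> g n k) < ennreal (\<epsilon> i / 2)"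
    show "eventually (\<lambda>k. \<forall>y\<in>Y i k.
        ennreal (\<epsilon> i / 2) \<le> nrm k (inv\<^bsub>G k\<^esub> y \<otimes>\<^bsub>G k\<^esub> g n k)) U"
    \<comment> \<open>Otherwise elements of the fibres that are too close exist for almost all
      \<open>k\<close>; together they form a member of the internal set too close to
      \<open>g n\<close>.\<close>
    proof (rule ccontr)
      assume "\<not> ?thesis"
      then have ev: "eventually (\<lambda>k. \<exists>y. ?B k y) U"
        unfolding not_eventually_ultrafilter[OF ultra]
        by (rule eventually_mono) (auto simp: not_le)
      then have "\<exists>k. \<exists>y. ?B k y"
        using nontrivial eventually_happens by blast
      \<comment> \<open>One nonempty fibre makes all of them nonempty by \<open>uniform\<close>,
        which provides default values at the remaining coordinates.\<close>
      then have "\<forall>k. Y i k \<noteq> {}"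
        using uniform by blast
      then have "\<exists>y. y \<in> Y i k \<and> ((\<exists>y. ?B k y) \<longrightarrow> ?B k y)" for k
        by blast
      then obtain y where yY: "\<And>k. y k \<in> Y i k" and y: "\<And>k. \<exists>y. ?B k y \<Longrightarrow> ?B k (y k)"
        by metis
      have y_PiE: "y \<in> (\<Pi>\<^sub>E n\<in>UNIV. Y i n)"
        using yY by auto
      then have yP: "y \<in> carrier P"
        using YP by blast
      have "seq_norm (inv\<^bsub>P\<^esub> y \<otimes>\<^bsub>P\<^esub> g n) \<le> ennreal (\<epsilon> i / 2)"
      proof (rule seq_norm_leI, rule eventually_mono[OF ev])
        fix k assume "\<exists>y. ?B k y"
        from y[OF this] show "nrm k ((inv\<^bsub>P\<^esub> y \<otimes>\<^bsub>P\<^esub> g n) k) \<le> ennreal (\<epsilon> i / 2)"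
          using yP by (simp add: mult_P inv_P less_imp_le)
      qed
      \<comment> \<open>The limit only preserves the weak bound \<open>\<epsilon> i / 2\<close>;
        halving leaves room for the strict inequality that the open ball requires.\<close>
      also have "\<dots> < ennreal (\<epsilon> i)"
        using assms(3)[of i] by (intro ennreal_lessI) auto
      finally have "cls (g n) \<in> X i <#>\<^bsub>Q\<^esub> ball (\<epsilon> i)"
        using mem_image_cls_mult_ball[OF YP gP] Y(2) y_PiE by auto
      with g i show False by auto
    qed
  qed
  from ultrafilter_diagonal[OF ultra assms(1), of A, OF this]
  obtain m where m: "\<And>n. eventually (\<lambda>k. n \<le> m k \<and> A (m k) k) U"
    by blast
  \<comment> \<open>The diagonal point: coordinate \<open>k\<close> is taken from the sequence with
    index \<open>m k\<close>.\<close>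
  define h where "h k = g (m k) k" for k
  have hP: "h \<in> carrier P"
    using gP by (auto simp: h_def mem_carrier_P)
  have "cls h \<notin> X i" for i
  proof
    assume "cls h \<in> X i"
    then obtain y where y: "y \<in> (\<Pi>\<^sub>E n\<in>UNIV. Y i n)" "cls h = cls y"
      using Y(2) by auto
    then have yP: "y \<in> carrier P"
      using YP by blast
    \<comment> \<open>As soon as \<open>i \<le> m k\<close>, the bound for \<open>i\<close> is among
      those collected in \<open>A (m k) k\<close>.\<close>
    have "ennreal (\<epsilon> i / 2) \<le> seq_norm (inv\<^bsub>P\<^esub> y \<otimes>\<^bsub>P\<^esub> h)"
    proof (rule seq_norm_geI, rule eventually_mono[OF m[of i]])
      fix k assume "i \<le> m k \<and> A (m k) k"
      moreover have "y k \<in> Y i k"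
        using y(1) by auto
      ultimately show "ennreal (\<epsilon> i / 2) \<le> nrm k ((inv\<^bsub>P\<^esub> y \<otimes>\<^bsub>P\<^esub> h) k)"
        using yP by (auto simp: A_def h_def mult_P inv_P)
    qed
    with y(2) cls_eq_iff[OF hP yP] assms(3)[of i] show False
      by (simp add: ennreal_eq_0_iff)
  qed
  then show ?thesis
    using hP by (auto simp: carrier_Q)
qed

section \<open>Small sequences\<close>

text \<open>All the neighbourhoods lie in the carrier, so failing to equal it means missing a
  point.\<close>

lemma small_seqs_iff:
  assumes "\<And>m. X m \<subseteq> carrier Q"
  shows "es \<in> small_seqs U G nrm X \<longleftrightarrow> es \<noteq> [] \<and> (\<forall>e\<in>set es. e > 0) \<and>
    (\<exists>a\<in>carrier Q. \<forall>i<length es. a \<notin> X i <#>\<^bsub>Q\<^esub> ball (es ! i))"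
proof -
  have "(\<Union>i<length es. X i <#>\<^bsub>Q\<^esub> ball (es ! i)) \<subseteq> carrier Q"
    using mult_ball_subset assms by blast
  then have "carrier Q \<noteq> (\<Union>i<length es. X i <#>\<^bsub>Q\<^esub> ball (es ! i)) \<longleftrightarrow>
      (\<exists>a\<in>carrier Q. a \<notin> (\<Union>i<length es. X i <#>\<^bsub>Q\<^esub> ball (es ! i)))"
    by blast
  then show ?thesis
    by (simp add: small_seqs_def Ball_def)
qed

text \<open>A point missed by the longer union is missed by the shorter one. The empty prefix is
  excluded because \<open>small_seqs\<close> contains only nonempty lists.\<close>

lemma small_seqs_prefix:
  assumes "\<And>m. X m \<subseteq> carrier Q"
    and "es \<in> small_seqs U G nrm X" "prefix ds es" "ds \<noteq> []"
  shows "ds \<in> small_seqs U G nrm X"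
proof -
  obtain zs where zs: "es = ds @ zs"
    using assms(3) by (auto simp: prefix_def)
  obtain a where "a \<in> carrier Q" "\<forall>i<length es. a \<notin> X i <#>\<^bsub>Q\<^esub> ball (es ! i)"
    using assms(2) unfolding small_seqs_iff[OF assms(1)] by auto
  moreover have "es ! i = ds ! i" if "i < length ds" for i
    using that by (simp add: zs nth_append)
  moreover have "i < length es" if "i < length ds" for i
    using that by (simp add: zs)
  ultimately have "\<forall>i<length ds. a \<notin> X i <#>\<^bsub>Q\<^esub> ball (ds ! i)"
    by metis
  with \<open>a \<in> carrier Q\<close> show ?thesis
    using assms(2,4) unfolding small_seqs_iff[OF assms(1)] zs by auto
qed

lemma covers_iff_no_infinite_path:
  assumes "nonprincipal U" "\<And>m. metrically_internal U G nrm (X m)"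
  shows "carrier Q = (\<Union>m. X m) \<longleftrightarrow> \<not> (\<exists>\<epsilon>. infinite_path (small_seqs U G nrm X) \<epsilon>)"
proof -
  have sub: "X m \<subseteq> carrier Q" for m
    using assms(2) by (rule metrically_internal_subset)
  \<comment> \<open>A path provides a missed point for each \<open>n\<close> separately; saturation
    later replaces these by a single one.\<close>
  have path_iff: "infinite_path (small_seqs U G nrm X) \<epsilon> \<longleftrightarrow> (\<forall>n. \<epsilon> n > 0) \<and>
      (\<forall>n. \<exists>a\<in>carrier Q. \<forall>i\<le>n. a \<notin> X i <#>\<^bsub>Q\<^esub> ball (\<epsilon> i))" for \<epsilon>
    unfolding infinite_path_def small_seqs_iff[OF sub]
    by (auto simp del: upt_Suc simp: less_Suc_eq_le)
  show ?thesis
  proof (intro iffI notI)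
    assume cover: "carrier Q = (\<Union>m. X m)" and "\<exists>\<epsilon>. infinite_path (small_seqs U G nrm X) \<epsilon>"
    then obtain \<epsilon> where "infinite_path (small_seqs U G nrm X) \<epsilon>" by blast
    then have "\<epsilon> n > 0" "\<exists>a\<in>carrier Q. \<forall>i\<le>n. a \<notin> X i <#>\<^bsub>Q\<^esub> ball (\<epsilon> i)" for n
      unfolding path_iff by blast+
    then have "\<exists>a\<in>carrier Q. \<forall>i. a \<notin> X i"
      by (rule metrically_internal_saturated[OF assms])
    with cover show False by auto
  next
    assume no_path: "\<not> (\<exists>\<epsilon>. infinite_path (small_seqs U G nrm X) \<epsilon>)"
    show "carrier Q = (\<Union>m. X m)"
    proof (rule ccontr)
      assume "carrier Q \<noteq> (\<Union>m. X m)"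
      moreover have "(\<Union>m. X m) \<subseteq> carrier Q"
        using sub by (rule UN_least)
      ultimately have "\<not> carrier Q \<subseteq> (\<Union>m. X m)"
        by (metis subset_antisym)
      then obtain a where a: "a \<in> carrier Q" "\<And>m. a \<notin> X m"
        by auto
      \<comment> \<open>Contrapositive of closedness. The same \<open>a\<close> then witnesses
        smallness of every initial segment of the chosen radii.\<close>
      then have "\<exists>e>0. a \<notin> X m <#>\<^bsub>Q\<^esub> ball e" for m
        using metrically_internal_closed[OF assms(1) assms(2)] by blast
      then obtain \<epsilon> where "\<And>m. \<epsilon> m > 0 \<and> a \<notin> X m <#>\<^bsub>Q\<^esub> ball (\<epsilon> m)"
        by metis
      then have "infinite_path (small_seqs U G nrm X) \<epsilon>"
        using a(1) by (auto simp: path_iff)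
      with no_path show False by blast
    qed
  qed
qed

end

section \<open>Well-foundedness and infinite branches of trees\<close>

text \<open>A descending chain consists of comparable lists of unbounded length, so they glue to an
  infinite sequence whose nonempty initial segments lie in \<open>T\<close> by prefix closure.
  Conversely, the initial segments of a branch form a descending chain.\<close>

lemma not_well_founded_tree_iff:
  assumes prefix_closed: "\<And>s t. s \<in> T \<Longrightarrow> prefix t s \<Longrightarrow> t \<noteq> [] \<Longrightarrow> t \<in> T"
  shows "\<not> well_founded_tree T \<longleftrightarrow> (\<exists>f. \<forall>n. map f [0..<Suc n] \<in> T)"
proof
  assume "\<not> well_founded_tree T"
  then obtain s where s: "\<And>i. s i \<in> T" "\<And>i. strict_prefix (s i) (s (Suc i))"
    unfolding well_founded_tree_def wf_iff_no_infinite_down_chain by auto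
  have mono: "prefix (s i) (s j)" if "i \<le> j" for i j
    using that s(2) by (induction rule: dec_induct) 
      (auto intro: prefix_order.trans simp: strict_prefix_def)
  \<comment> \<open>The chain may skip lengths, so only a lower bound on the length is
    available.\<close>
  have len: "i \<le> length (s i)" for i
    by (induction i) (use prefix_length_less[OF s(2)] in \<open>auto intro: Suc_leI le_less_trans\<close>)
  \<comment> \<open>The shift to \<open>Suc n\<close> guarantees that entry \<open>n\<close> exists,
    since \<open>s (Suc n)\<close> has length at least \<open>n + 1\<close>.\<close>
  define f where "f n = s (Suc n) ! n" for n
  have "map f [0..<Suc n] = take (Suc n) (s (Suc n))" for n
  proof (rule nth_equalityI)
    show "length (map f [0..<Suc n]) = length (take (Suc n) (s (Suc n)))"
      using len[of "Suc n"] by simp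
    fix i assume "i < length (map f [0..<Suc n])"
    then have i: "i < Suc n" by simp
    then have "prefix (s (Suc i)) (s (Suc n))" "i < length (s (Suc i))"
      using mono[of "Suc i" "Suc n"] len[of "Suc i"] by auto
    then have "s (Suc i) ! i = s (Suc n) ! i"
      by (auto simp: prefix_def nth_append)
    with i show "map f [0..<Suc n] ! i = take (Suc n) (s (Suc n)) ! i"
      by (simp add: f_def del: upt_Suc)
  qed
  then have "map f [0..<Suc n] \<in> T" for n
    using prefix_closed[OF s(1), of "map f [0..<Suc n]" "Suc n"] take_is_prefix[of "Suc n" "s (Suc n)"]
      len[of "Suc n"]
    by force
  then show "\<exists>f. \<forall>n. map f [0..<Suc n] \<in> T" by blast
next
  assume "\<exists>f. \<forall>n. map f [0..<Suc n] \<in> T"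
  then obtain f where "\<And>n. map f [0..<Suc n] \<in> T" by blast
  moreover have "strict_prefix (map f [0..<Suc n]) (map f [0..<Suc (Suc n)])" for n
    by (rule strict_prefixI'[of _ _ "f (Suc n)" "[]"]) simp
  ultimately have "\<exists>s. \<forall>i. s i \<in> T \<and> s (Suc i) \<in> T \<and> strict_prefix (s i) (s (Suc i))"
    by (intro exI[of _ "\<lambda>n. map f [0..<Suc n]"]) blast
  then show "\<not> well_founded_tree T"
    unfolding well_founded_tree_def wf_iff_no_infinite_down_chain by auto
qed

theorem theorem4p14:
  fixes G :: "nat \<Rightarrow> ('a, 'b) monoid_scheme"
    and nrm :: "nat \<Rightarrow> 'a \<Rightarrow> ennreal"
    and U :: "nat filter"
    and X :: "nat \<Rightarrow> (nat \<Rightarrow> 'a) set set"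
  assumes "\<And>n. metric_group (G n) (nrm n)"
    and "Sup {nrm n g | n g. g \<in> carrier (G n)} < \<infinity>"
    and "ultrafilter U" and "nonprincipal U"
    and "\<And>m. metrically_internal U G nrm (X m)"
  shows "(carrier (met_ultraproduct U G nrm) = (\<Union>m. X m) \<longleftrightarrow>
            \<not> (\<exists>\<epsilon>. infinite_path (small_seqs U G nrm X) \<epsilon>)) \<and>
         (\<not> (\<exists>\<epsilon>. infinite_path (small_seqs U G nrm X) \<epsilon>) \<longleftrightarrow>
            well_founded_tree (small_seqs U G nrm X))"
proof -
  interpret metric_ultraproduct G nrm U
    using assms(1,3) by (rule metric_ultraproduct.intro)
  let ?T = "small_seqs U G nrm X"
  have "\<not> well_founded_tree ?T \<longleftrightarrow> (\<exists>\<epsilon>. \<forall>n. map \<epsilon> [0..<Suc n] \<in> ?T)"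
    using small_seqs_prefix[of X] metrically_internal_subset[OF assms(5)]
    by (intro not_well_founded_tree_iff) blast
  \<comment> \<open>Entry \<open>n\<close> is the last one of this segment, so membership in the
    tree already forces its positivity and any branch is an infinite path.\<close>
  moreover have "\<epsilon> n > 0" if "map \<epsilon> [0..<Suc n] \<in> ?T" for \<epsilon> n
    using that by (auto simp: small_seqs_def)
  ultimately have "\<not> well_founded_tree ?T \<longleftrightarrow> (\<exists>\<epsilon>. infinite_path ?T \<epsilon>)"
    unfolding infinite_path_def by blast
  then show ?thesis
    using covers_iff_no_infinite_path[of X, OF assms(4,5)] by blast
qed

end
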